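(* (1) For all integers $k\ge 0$ and $n\ge 1$, $p^1_{n,n+k;\le n+k}=p_{n-1,n+k;\le n+k}$. (2) For all integers $k\ge 1$ and $n\ge 1$, $$p^1_{n,n+k;\le n+k}=\sum_{i=1}^{n}\binom{n-1}{i-1}\,p^1_{i,i+k-1;\le i+k-1}\,p_{n-i}.$$
   Context: Parking model: there are $m$ parking spaces in a line, numbered $1,\dots,m$. A preference set of length $n$ is a sequence $(a_1,\dots,a_n)$ of integers with $1\le a_i\le m$; cars $1,\dots,n$ arrive in order, car $i$ parks in the first unoccupied space numbered $\ge a_i$ if one exists, otherwise it fails to park. A $k$-flaw preference set is one where exactly $k$ cars fail to park; a $0$-flaw preference set is a parking function. $p_{n,m;\le s;k}$ is the number of $k$-flaw preference sets of length $n$ with $m$ spaces and all $a_i\le s$, and $p^l_{n,m;\le s;k}$ the number of those with $a_1=l$. Omitted $k$ means $k=0$; $p_j$ (no $m$, no $s$) denotes the number of parking functions of length $j$ with $j$ spaces, i.e. $p_j=(j+1)^{j-1}$, with $p_0=1$. For length $0$ the unique (empty) sequence counts as a parking function, so counts of parking functions of length $0$ equal $1$. *)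

theory Defs
  imports Main
begin

text \<open>
  \<open>flaws m U as\<close> counts the cars of \<open>as\<close> that fail to park in the spaces \<open>1, \<dots>, m\<close>,
  when the spaces in \<open>U\<close> are already occupied.
\<close>

fun flaws :: "nat \<Rightarrow> nat set \<Rightarrow> nat list \<Rightarrow> nat" where
  "flaws m U [] = 0"
| "flaws m U (a # as) =
     (let F = {j \<in> {a..m}. j \<notin> U} in
      if F = {} then Suc (flaws m U as) else flaws m (insert (Min F) U) as)"

definition preference_sets :: "nat \<Rightarrow> nat \<Rightarrow> nat list set" where
  "preference_sets n m = {as. length as = n \<and> set as \<subseteq> {1..m}}"

definition flaw_preference_sets :: "nat \<Rightarrow> nat \<Rightarrow> nat \<Rightarrow> nat \<Rightarrow> nat list set" where
  "flaw_preference_sets n m s k =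
     {as \<in> preference_sets n m. (\<forall>a \<in> set as. a \<le> s) \<and> flaws m {} as = k}"

text \<open>
  The numbers \<open>p\<^bsub>n,m;\<le>s;k\<^esub>\<close> and, for sequences starting with \<open>l\<close>,
  \<open>p\<^bsup>l\<^esup>\<^bsub>n,m;\<le>s;k\<^esub>\<close>.
\<close>

definition num_flaw :: "nat \<Rightarrow> nat \<Rightarrow> nat \<Rightarrow> nat \<Rightarrow> nat" where
  "num_flaw n m s k = card (flaw_preference_sets n m s k)"

definition num_flaw_first :: "nat \<Rightarrow> nat \<Rightarrow> nat \<Rightarrow> nat \<Rightarrow> nat \<Rightarrow> nat" where
  "num_flaw_first l n m s k =
     card {as \<in> flaw_preference_sets n m s k. as \<noteq> [] \<and> hd as = l}"

definition num_parking :: "nat \<Rightarrow> nat" where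
  "num_parking j = num_flaw j j j 0"

lemma finite_flaw_preference_sets: "finite (flaw_preference_sets n m s k)"
proof (rule finite_subset)
  show "flaw_preference_sets n m s k \<subseteq> {as. set as \<subseteq> {1..m} \<and> length as = n}"
    by (auto simp: flaw_preference_sets_def preference_sets_def)
qed (simp add: finite_lists_length_eq)

end

theory Submission
  imports Defs
begin

text \<open>
  All cars park iff for every \<open>j\<close> at most \<open>m + 1 - j\<close> of them prefer a space \<open>\<ge> j\<close>. Prepending a
  car that prefers space 1 only affects the condition for \<open>j = 1\<close>, which bounds the number of cars;
  this gives part (1). Writing \<open>c n m\<close> for the number of parking functions of \<open>n\<close> cars on \<open>m\<close>
  spaces, removing the cars that prefer space 1 gives
  \<open>c n (m + 1) = (\<Sum>t\<le>n. (n choose t) * c t m)\<close> for \<open>n \<le> m + 1\<close>. By part (1), part (2) reads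
  \<open>c N (N + k + 1) = (\<Sum>j\<le>N. (N choose j) * c j (j + k) * c (N - j) (N - j))\<close>, and it
  follows from the recurrence by induction on the number of spaces, exchanging two sums.
\<close>

section \<open>Counting criterion for parking\<close>

text \<open>Here \<open>p\<close> is the space taken by a car that prefers \<open>a\<close>. Since
  no space from \<open>a\<close> up to \<open>p - 1\<close> is free, the free spaces counted from
  any \<open>j\<close> between \<open>a\<close> and \<open>p\<close> are those counted from
  \<open>a\<close>.\<close>

lemma free_spaces_insert_Min:
  fixes m a j :: nat
  assumes F: "{i \<in> {a..m}. i \<notin> U} \<noteq> {}"
    and p: "p = Min {i \<in> {a..m}. i \<notin> U}"
  shows "card {i \<in> {j..m}. i \<notin> U} =
      card {i \<in> {j..m}. i \<notin> insert p U} + (if j \<le> p then 1 else 0)"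
    and "a \<le> p"
    and "\<lbrakk>a \<le> j; j \<le> p\<rbrakk> \<Longrightarrow> {i \<in> {j..m}. i \<notin> U} = {i \<in> {a..m}. i \<notin> U}"
proof -
  have mem: "p \<in> {i \<in> {a..m}. i \<notin> U}"
    unfolding p by (rule Min_in) (use F in auto)
  then show "a \<le> p" by simp
  have least: "p \<le> i" if "i \<in> {i \<in> {a..m}. i \<notin> U}" for i
    unfolding p by (rule Min_le) (use that in auto)
  show "card {i \<in> {j..m}. i \<notin> U} =
      card {i \<in> {j..m}. i \<notin> insert p U} + (if j \<le> p then 1 else 0)"
  proof (cases "j \<le> p")
    case True
    then have "{i \<in> {j..m}. i \<notin> U} = insert p {i \<in> {j..m}. i \<notin> insert p U}"
      using mem by auto
    then show ?thesis using True by simp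
  next
    case False
    then have "{i \<in> {j..m}. i \<notin> U} = {i \<in> {j..m}. i \<notin> insert p U}"
      by auto
    then show ?thesis using False by simp
  qed
  show "{i \<in> {j..m}. i \<notin> U} = {i \<in> {a..m}. i \<notin> U}" if "a \<le> j" "j \<le> p"
    using that least by fastforce
qed

lemma length_filter_ge_antimono:
  fixes as :: "nat list"
  assumes "i \<le> j"
  shows "length (filter ((\<le>) j) as) \<le> length (filter ((\<le>) i) as)"
  using assms by (induction as) auto

text \<open>A Hall-type condition. Parking the first car lowers the number of free spaces for j
  \<le> \<open>p\<close> and the number of cars still to be placed for j \<le> \<open>a\<close>, so
  only j with \<open>a\<close> < j \<le> \<open>p\<close> needs an argument.\<close>

lemma flaws_eq_0_iff:
  "flaws m U as = 0 \<longleftrightarrow> (\<forall>j. length (filter ((\<le>) j) as) \<le> card {i \<in> {j..m}. i \<notin> U})"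
proof (induction as arbitrary: U)
  case Nil
  then show ?case by simp
next
  case (Cons a as)
  define F where "F = {i \<in> {a..m}. i \<notin> U}"
  show ?case
  proof (cases "F = {}")
    case True
    then have "flaws m U (a # as) \<noteq> 0" by (simp add: F_def)
    moreover have "\<not> length (filter ((\<le>) a) (a # as)) \<le> card {i \<in> {a..m}. i \<notin> U}"
      using True by (simp add: F_def del: Collect_empty_eq)
    ultimately show ?thesis by blast
  next
    case False
    define p where "p = Min F"
    define cnt where "cnt j = length (filter ((\<le>) j) as)" for j
    define free where "free j = card {i \<in> {j..m}. i \<notin> U}" for j
    define free' where "free' j = card {i \<in> {j..m}. i \<notin> insert p U}" for j
    note Min_cond = free_spaces_insert_Min[OF False[unfolded F_def] p_def[unfolded F_def]]
    have "flaws m U (a # as) = 0 \<longleftrightarrow> flaws m (insert p U) as = 0"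
      using False unfolding F_def p_def flaws.simps Let_def by (simp only: if_False)
    also have "\<dots> \<longleftrightarrow> (\<forall>j. cnt j \<le> free' j)"
      unfolding Cons.IH cnt_def free'_def ..
    also have "\<dots> \<longleftrightarrow> (\<forall>j. cnt j + (if j \<le> a then 1 else 0) \<le> free j)"
    proof (intro iffI allI)
      fix j assume "\<forall>j. cnt j \<le> free' j"
      then show "cnt j + (if j \<le> a then 1 else 0) \<le> free j"
        using Min_cond(1)[of j] Min_cond(2) unfolding free_def free'_def
        by (auto intro: le_trans dest: spec[of _ j])
    next
      fix j assume *: "\<forall>j. cnt j + (if j \<le> a then 1 else 0) \<le> free j"
      show "cnt j \<le> free' j"
      \<comment> \<open>In this range space \<open>p\<close> is lost but the parked car was not
        counted. The missing unit comes from the condition at \<open>a\<close>, where the car is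
        counted and equally many spaces are free.\<close>
      proof (cases "a < j \<and> j \<le> p")
        case True
        have "free j = free a"
          using Min_cond(3)[of j] True unfolding free_def by simp
        moreover have "free j = free' j + 1"
          using Min_cond(1)[of j] True unfolding free_def free'_def by simp
        moreover have "cnt j \<le> cnt a"
          using True unfolding cnt_def by (intro length_filter_ge_antimono) simp
        ultimately show ?thesis using *[rule_format, of a] by simp
      next
        case False
        then show ?thesis
          using Min_cond(1)[of j] Min_cond(2) *[rule_format, of j]
          unfolding free_def free'_def by (auto split: if_splits)
      qed
    qed
    also have "\<dots> \<longleftrightarrow>
        (\<forall>j. length (filter ((\<le>) j) (a # as)) \<le> card {i \<in> {j..m}. i \<notin> U})"
      unfolding cnt_def free_def by (intro all_cong1) simp
    finally show ?thesis .
  qed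
qed

text \<open>The conditions at j = 0 and j = 1 both count all cars, and together they say n \<le> m.
  Splitting them off leaves conditions that entries equal to 1 cannot affect.\<close>

lemma mem_flaw_preference_sets_0_iff:
  "as \<in> flaw_preference_sets n m m 0 \<longleftrightarrow>
     length as = n \<and> set as \<subseteq> {1..m} \<and> n \<le> m \<and>
     (\<forall>j\<ge>2. length (filter ((\<le>) j) as) \<le> Suc m - j)"
proof -
  have "(\<forall>j. length (filter ((\<le>) j) as) \<le> Suc m - j) \<longleftrightarrow>
      length as \<le> m \<and> (\<forall>j\<ge>2. length (filter ((\<le>) j) as) \<le> Suc m - j)"
    if "set as \<subseteq> {1..m}"
  proof -
    have "filter ((\<le>) (Suc 0)) as = as" "filter ((\<le>) 0) as = as"
      using that by (auto simp: filter_id_conv)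
    moreover have "j = 0 \<or> j = Suc 0 \<or> 2 \<le> j" for j :: nat by linarith
    ultimately show ?thesis
      by (metis diff_Suc_Suc diff_zero le_Suc_eq)
  qed
  moreover have "flaws m {} as = 0 \<longleftrightarrow> (\<forall>j. length (filter ((\<le>) j) as) \<le> Suc m - j)"
    by (simp add: flaws_eq_0_iff del: atLeastAtMost_iff)
  ultimately show ?thesis
    unfolding flaw_preference_sets_def preference_sets_def by auto
qed

section \<open>Boundary values and sequences that begin with 1\<close>

lemma num_flaw_eq_0:
  assumes "m < n"
  shows "num_flaw n m m 0 = 0"
proof -
  have "flaw_preference_sets n m m 0 = {}"
    using assms by (auto simp: mem_flaw_preference_sets_0_iff)
  then show ?thesis by (simp add: num_flaw_def)
qed

lemma num_flaw_0 [simp]: "num_flaw 0 m m 0 = 1"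
proof -
  have "flaw_preference_sets 0 m m 0 = {[]}"
    by (auto simp: mem_flaw_preference_sets_0_iff)
  then show ?thesis by (simp add: num_flaw_def)
qed

text \<open>A leading 1 is invisible to the conditions with j \<ge> 2, and \<open>n < m\<close>
  leaves room for one more car.\<close>

lemma num_flaw_first_1:
  assumes "n < m"
  shows "num_flaw_first 1 (Suc n) m m 0 = num_flaw n m m 0"
proof -
  have "{as \<in> flaw_preference_sets (Suc n) m m 0. as \<noteq> [] \<and> hd as = 1} =
      (#) 1 ` flaw_preference_sets n m m 0"
  proof (intro set_eqI)
    fix as
    show "as \<in> {as \<in> flaw_preference_sets (Suc n) m m 0. as \<noteq> [] \<and> hd as = 1} \<longleftrightarrow>
        as \<in> (#) 1 ` flaw_preference_sets n m m 0"
      using assms by (cases as) (auto simp: mem_flaw_preference_sets_0_iff image_iff)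
  qed
  then show ?thesis
    by (simp add: num_flaw_first_def num_flaw_def card_image)
qed

section \<open>Recurrence in the number of spaces\<close>

text \<open>Choose the t positions whose entries differ from \<open>x\<close>, then the subsequence
  on them, which alone decides \<open>Q\<close>. The induction keeps \<open>Q\<close> arbitrary
  because a head \<open>a\<close> from \<open>A\<close> turns it into
  \<open>\<lambda>bs. Q (a # bs)\<close>.\<close>

lemma card_lists_filter_neq:
  assumes "finite A" "x \<notin> A"
  shows "card {as. length as = n \<and> set as \<subseteq> insert x A \<and> Q (filter ((\<noteq>) x) as)} =
    (\<Sum>t\<le>n. (n choose t) * card {bs. length bs = t \<and> set bs \<subseteq> A \<and> Q bs})"
proof (induction n arbitrary: Q)
  case 0
  have "{as. length as = 0 \<and> set as \<subseteq> insert x A \<and> Q (filter ((\<noteq>) x) as)} =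
      {bs. length bs = 0 \<and> set bs \<subseteq> A \<and> Q bs}"
    by auto
  then show ?case by simp
next
  case (Suc n)
  define L where
    "L P = {as. length as = n \<and> set as \<subseteq> insert x A \<and> P (filter ((\<noteq>) x) as)}" for P
  define B where "B P t = {bs. length bs = t \<and> set bs \<subseteq> A \<and> P bs}" for P t
  have fin_L: "finite (L P)" for P
    by (rule finite_subset[of _ "{as. set as \<subseteq> insert x A \<and> length as = n}"])
      (use assms in \<open>auto simp: L_def finite_lists_length_eq\<close>)
  have fin_B: "finite (B P t)" for P t
    by (rule finite_subset[of _ "{as. set as \<subseteq> A \<and> length as = t}"])
      (use assms in \<open>auto simp: B_def finite_lists_length_eq\<close>)
  have L: "card (L P) = (\<Sum>t\<le>n. (n choose t) * card (B P t))" for P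
    unfolding L_def B_def by (rule Suc.IH)
  have B_Suc: "card (B Q (Suc t)) = (\<Sum>a\<in>A. card (B (\<lambda>bs. Q (a # bs)) t))" for t
  proof -
    have "B Q (Suc t) = (\<Union>a\<in>A. (#) a ` B (\<lambda>bs. Q (a # bs)) t)"
      by (auto simp: B_def length_Suc_conv)
    also have "card \<dots> = (\<Sum>a\<in>A. card ((#) a ` B (\<lambda>bs. Q (a # bs)) t))"
      using assms fin_B by (intro card_UN_disjoint) auto
    finally show ?thesis by (simp add: card_image)
  qed
  have "{as. length as = Suc n \<and> set as \<subseteq> insert x A \<and> Q (filter ((\<noteq>) x) as)} =
      (#) x ` L Q \<union> (\<Union>a\<in>A. (#) a ` L (\<lambda>bs. Q (a # bs)))"
    using assms(2) by (auto simp: L_def length_Suc_conv image_iff split: if_splits)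
  also have "card \<dots> = card ((#) x ` L Q) + card (\<Union>a\<in>A. (#) a ` L (\<lambda>bs. Q (a # bs)))"
    using assms fin_L by (intro card_Un_disjoint) auto
  also have "card (\<Union>a\<in>A. (#) a ` L (\<lambda>bs. Q (a # bs))) =
      (\<Sum>a\<in>A. card ((#) a ` L (\<lambda>bs. Q (a # bs))))"
    using assms fin_L by (intro card_UN_disjoint) auto
  also have "\<dots> = (\<Sum>t\<le>n. (n choose t) * card (B Q (Suc t)))"
    by (simp add: card_image L B_Suc sum_distrib_left) (rule sum.swap)
  \<comment> \<open>The added term t = \<open>Suc n\<close> has coefficient 0; it aligns the two
    sums for Pascal's rule.\<close>
  also have "card ((#) x ` L Q) = (\<Sum>t\<le>Suc n. (n choose t) * card (B Q t))"
    by (simp add: card_image L)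
  also have "(\<Sum>t\<le>Suc n. (n choose t) * card (B Q t)) +
        (\<Sum>t\<le>n. (n choose t) * card (B Q (Suc t))) =
      (\<Sum>t\<le>Suc n. (Suc n choose t) * card (B Q t))"
    unfolding sum.atMost_Suc_shift by (simp add: sum.distrib algebra_simps)
  finally show ?case unfolding B_def .
qed

text \<open>The t cars that do not prefer space 1, with preferences lowered by one, form a parking
  function on m spaces; the other cars are constrained only through the total n.\<close>

lemma num_flaw_Suc:
  assumes "n \<le> Suc m"
  shows "num_flaw n (Suc m) (Suc m) 0 = (\<Sum>t\<le>n. (n choose t) * num_flaw t m m 0)"
proof -
  \<comment> \<open>The parking criterion for m + 1 spaces without its bound on the length, hence
    blind to entries equal to 1.\<close>
  define Q where "Q bs \<longleftrightarrow> (\<forall>j\<ge>2. length (filter ((\<le>) j) bs) \<le> Suc (Suc m) - j)"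
    for bs :: "nat list"
  have filter_filter: "filter ((\<le>) j) (filter ((\<noteq>) 1) as) = filter ((\<le>) j) as"
    if "2 \<le> j" for as :: "nat list" and j
    using that by (auto intro!: filter_cong)
  have "{1..Suc m} = insert 1 {2..Suc m}" by auto
  moreover have "Q (filter ((\<noteq>) 1) as) \<longleftrightarrow> Q as" for as
    unfolding Q_def using filter_filter by (simp del: List.filter_filter)
  ultimately have "flaw_preference_sets n (Suc m) (Suc m) 0 =
      {as. length as = n \<and> set as \<subseteq> insert 1 {2..Suc m} \<and> Q (filter ((\<noteq>) 1) as)}"
    using assms
    by (intro set_eqI) (auto simp only: mem_flaw_preference_sets_0_iff mem_Collect_eq Q_def)
  then have "num_flaw n (Suc m) (Suc m) 0 =
      (\<Sum>t\<le>n. (n choose t) * card {bs. length bs = t \<and> set bs \<subseteq> {2..Suc m} \<and> Q bs})"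
    unfolding num_flaw_def by (simp only:) (rule card_lists_filter_neq; simp)
  also have "\<dots> = (\<Sum>t\<le>n. (n choose t) * num_flaw t m m 0)"
  proof (intro sum.cong refl arg_cong2[where f = "(*)"])
    fix t
    have Q_map: "Q (map Suc as) \<longleftrightarrow>
        length as \<le> m \<and> (\<forall>j\<ge>2. length (filter ((\<le>) j) as) \<le> Suc m - j)"
      if "set as \<subseteq> {1..m}" for as
    proof -
      have "filter ((\<le>) (Suc 0)) as = as"
        using that by (auto simp: filter_id_conv)
      then have first: "length as \<le> m \<longleftrightarrow> length (filter ((\<le>) 1) as) \<le> Suc m - 1" by simp
      \<comment> \<open>The shift moves the condition at j = 2 to j = 1, where it becomes the length
        bound for m spaces.\<close>
      have "Q (map Suc as) \<longleftrightarrow> (\<forall>j\<ge>1. length (filter ((\<le>) j) as) \<le> Suc m - j)"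
      proof -
        have "(\<forall>j\<ge>2. P j) \<longleftrightarrow> (\<forall>j\<ge>1. P (Suc j))" for P :: "nat \<Rightarrow> bool"
          by (metis Suc_1 Suc_le_D Suc_le_mono)
        then show ?thesis
          unfolding Q_def by (simp add: filter_map o_def)
      qed
      also have "\<dots> \<longleftrightarrow> length as \<le> m \<and>
          (\<forall>j\<ge>2. length (filter ((\<le>) j) as) \<le> Suc m - j)"
      proof -
        have one_le: "1 \<le> j \<longleftrightarrow> j = 1 \<or> 2 \<le> j" for j :: nat by linarith
        have "(\<forall>j\<ge>1. P j) \<longleftrightarrow> P 1 \<and> (\<forall>j\<ge>2. P j)" for P :: "nat \<Rightarrow> bool"
          unfolding one_le by iprover
        then show ?thesis unfolding first .
      qed
      finally show ?thesis .
    qed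
    have "{bs. length bs = t \<and> set bs \<subseteq> {2..Suc m} \<and> Q bs} =
        map Suc ` flaw_preference_sets t m m 0" (is "?L = ?R")
    proof
      show "?R \<subseteq> ?L"
      proof
        fix bs assume "bs \<in> ?R"
        then obtain as where "bs = map Suc as" "as \<in> flaw_preference_sets t m m 0" by auto
        then show "bs \<in> ?L"
          using Q_map[of as] by (auto simp: mem_flaw_preference_sets_0_iff)
      qed
      show "?L \<subseteq> ?R"
      proof
        fix bs assume bs: "bs \<in> ?L"
        define as where "as = map (\<lambda>b. b - 1) bs"
        have "map Suc as = bs"
          using bs unfolding as_def by (force simp: subset_iff intro: map_idI)
        moreover have "set as \<subseteq> {1..m}" "length as = t"
          using bs unfolding as_def by fastforce+
        ultimately show "bs \<in> ?R"
          using bs Q_map[of as]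
          by (intro image_eqI[of _ _ as]) (auto simp: mem_flaw_preference_sets_0_iff)
      qed
    qed
    then show "card {bs. length bs = t \<and> set bs \<subseteq> {2..Suc m} \<and> Q bs} = num_flaw t m m 0"
      by (simp add: num_flaw_def card_image inj_on_subset[OF inj_mapI])
  qed
  finally show ?thesis .
qed

section \<open>Convolution with parking functions\<close>

text \<open>Both sides weight by \<open>f j s\<close> the ways to pick disjoint subsets of sizes j
  and s from N elements. The left side picks their union of size t = j + s first, the right side the
  subset of size s.\<close>

lemma sum_triangle_exchange:
  fixes f :: "nat \<Rightarrow> nat \<Rightarrow> nat"
  shows "(\<Sum>t\<le>N. (N choose t) * (\<Sum>j\<le>t. (t choose j) * f j (t - j))) =
    (\<Sum>s\<le>N. (N choose s) * (\<Sum>j\<le>N - s. ((N - s) choose j) * f j s))"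
proof -
  have binom: "(N choose (j + s)) * ((j + s) choose j) = (N choose s) * ((N - s) choose j)"
    if "j + s \<le> N" for j s
    using choose_mult[of s "j + s" N] that
    by (simp add: binomial_symmetric[of j "j + s"])
  have "(\<Sum>t\<le>N. (N choose t) * (\<Sum>j\<le>t. (t choose j) * f j (t - j))) =
      (\<Sum>(t, j)\<in>(SIGMA t:{..N}. {..t}). (N choose t) * (t choose j) * f j (t - j))"
    by (simp add: sum_distrib_left sum.Sigma mult.assoc)
  also have "\<dots> = (\<Sum>(t, j)\<in>(SIGMA t:{..N}. {..t}).
      (N choose (t - j)) * ((N - (t - j)) choose j) * f j (t - j))"
  proof -
    have "(N choose t) * (t choose j) = (N choose (t - j)) * ((N - (t - j)) choose j)"
      if "t \<le> N" "j \<le> t" for t j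
      using binom[of j "t - j"] that by simp
    then show ?thesis
      by (intro sum.cong refl) (simp only: mem_Sigma_iff atMost_iff split_paired_all case_prod_conv)
  qed
  also have "\<dots> = (\<Sum>(s, j)\<in>(SIGMA s:{..N}. {..N - s}).
      (N choose s) * ((N - s) choose j) * f j s)"
    by (rule sum.reindex_bij_witness[of _ "\<lambda>(s, j). (j + s, j)" "\<lambda>(t, j). (t - j, j)"])
      auto
  also have "\<dots> = (\<Sum>s\<le>N. (N choose s) * (\<Sum>j\<le>N - s. ((N - s) choose j) * f j s))"
    by (simp add: sum_distrib_left sum.Sigma mult.assoc)
  finally show ?thesis .
qed

text \<open>Combinatorially, j counts the cars parked before the last empty space; the N - j cars
  after it fill all spaces there. The proof below is algebraic instead.\<close>

lemma num_flaw_convolution: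
  "num_flaw N (N + k + 1) (N + k + 1) 0 =
     (\<Sum>j\<le>N. (N choose j) * num_flaw j (j + k) (j + k) 0 * num_parking (N - j))"
proof (induction "N + k" arbitrary: N k rule: less_induct)
  case less
  define c where "c n m = num_flaw n m m 0" for n m
  have c_Suc: "c n (Suc m) = (\<Sum>t\<le>n. (n choose t) * c t m)" if "n \<le> Suc m" for n m
    unfolding c_def by (rule num_flaw_Suc[OF that])
  \<comment> \<open>The case distinction covers the terms whose second index would be
    \<open>N + k - s = 0\<close>, where the recurrence cannot be applied.\<close>
  define d where "d j s = (if s = N + k then 1 else c j (N + k - s - 1))" for j s
  \<comment> \<open>In the induction hypothesis for t cars on N + k spaces, the number of spaces in
    the first factor depends on t and j only through t - j. This gives the terms the shape that
    \<open>sum_triangle_exchange\<close> expects.\<close>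
  have inner: "c t (N + k) = (\<Sum>j\<le>t. (t choose j) * (d j (t - j) * c (t - j) (t - j)))"
    if "t \<le> N" for t
  proof (cases "t = N + k")
    case False
    define k' where "k' = N + k - t - 1"
    have k': "t + k' < N + k" "t + k' + 1 = N + k"
      using False that by (auto simp: k'_def)
    have "d j (t - j) = c j (j + k')" if "j \<le> t" for j
    proof -
      have "N + k - (t - j) - 1 = j + k'" "t - j \<noteq> N + k"
        using k' that by linarith+
      then show ?thesis by (simp add: d_def)
    qed
    then show ?thesis
      using less[OF k'(1)] k'(2) by (simp add: c_def num_parking_def mult.assoc)
  next
    case True
    \<comment> \<open>With no surplus space the induction hypothesis does not apply. For j > 0 the
      factor \<open>d j (t - j)\<close> counts j cars on j - 1 spaces and vanishes, so only j = 0
      remains.\<close>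
    have "(\<Sum>j\<le>t. (t choose j) * (d j (t - j) * c (t - j) (t - j))) =
        (\<Sum>j\<le>t. if j = 0 then c t t else 0)"
    proof (intro sum.cong refl)
      fix j assume "j \<in> {..t}"
      then have "d j (t - j) = 0" if "j \<noteq> 0"
        using that True by (auto simp: d_def c_def intro!: num_flaw_eq_0)
      then show "(t choose j) * (d j (t - j) * c (t - j) (t - j)) = (if j = 0 then c t t else 0)"
        using True by (simp add: d_def)
    qed
    then show ?thesis using True by simp
  qed
  \<comment> \<open>The recurrence read from right to left. If s = N + k, then k = 0 and s = N, and
    the value 1 of \<open>d\<close> matches \<open>c 0 0\<close>.\<close>
  have outer: "(\<Sum>j\<le>N - s. ((N - s) choose j) * d j s) = c (N - s) (N - s + k)"
    if "s \<le> N" for s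
  proof (cases "s = N + k")
    case True
    then show ?thesis using that by (simp add: d_def c_def)
  next
    case False
    then have "N - s + k = Suc (N + k - s - 1)" "N - s \<le> Suc (N + k - s - 1)"
      using that by linarith+
    then show ?thesis
      using False c_Suc[of "N - s" "N + k - s - 1"] by (simp add: d_def)
  qed
  have "c N (N + k + 1) = (\<Sum>t\<le>N. (N choose t) * c t (N + k))"
    using c_Suc[of N "N + k"] by simp
  also have "\<dots> = (\<Sum>t\<le>N. (N choose t) *
      (\<Sum>j\<le>t. (t choose j) * (d j (t - j) * c (t - j) (t - j))))"
    by (intro sum.cong refl) (simp add: inner)
  also have "\<dots> = (\<Sum>s\<le>N. (N choose s) * (\<Sum>j\<le>N - s. ((N - s) choose j) * (d j s * c s s)))"
    by (rule sum_triangle_exchange)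
  also have "\<dots> = (\<Sum>s\<le>N. (N choose s) * c (N - s) (N - s + k) * c s s)"
  proof (intro sum.cong refl)
    fix s assume "s \<in> {..N}"
    then have "c (N - s) (N - s + k) = (\<Sum>j\<le>N - s. ((N - s) choose j) * d j s)"
      by (simp only: atMost_iff outer)
    then show "(N choose s) * (\<Sum>j\<le>N - s. ((N - s) choose j) * (d j s * c s s)) =
        (N choose s) * c (N - s) (N - s + k) * c s s"
      by (simp only: sum_distrib_right mult.assoc)
  qed
  also have "\<dots> = (\<Sum>j\<le>N. (N choose j) * c j (j + k) * c (N - j) (N - j))"
    by (rule sum.reindex_bij_witness[of _ "\<lambda>j. N - j" "\<lambda>s. N - s"])
      (auto simp: binomial_symmetric[symmetric])
  finally show ?case by (simp add: c_def num_parking_def)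
qed

theorem theorem4p2:
  shows "(\<forall>k n :: nat. n \<ge> 1 \<longrightarrow>
           num_flaw_first 1 n (n + k) (n + k) 0 = num_flaw (n - 1) (n + k) (n + k) 0) \<and>
         (\<forall>k n :: nat. k \<ge> 1 \<longrightarrow> n \<ge> 1 \<longrightarrow>
           num_flaw_first 1 n (n + k) (n + k) 0 =
             (\<Sum>i = 1..n. ((n - 1) choose (i - 1)) *
                num_flaw_first 1 i (i + k - 1) (i + k - 1) 0 * num_parking (n - i)))"
proof (intro conjI allI impI)
  fix k n :: nat
  assume "1 \<le> n"
  then obtain N where "n = Suc N" by (cases n) auto
  then show "num_flaw_first 1 n (n + k) (n + k) 0 = num_flaw (n - 1) (n + k) (n + k) 0"
    by (simp add: num_flaw_first_1[unfolded One_nat_def])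
next
  fix k n :: nat
  assume "1 \<le> k" "1 \<le> n"
  then obtain N where n: "n = Suc N" by (cases n) auto
  have "num_flaw_first 1 n (n + k) (n + k) 0 = num_flaw N (N + k + 1) (N + k + 1) 0"
    using num_flaw_first_1[of N "Suc (N + k)"] by (simp add: n)
  also have "\<dots> = (\<Sum>j\<le>N. (N choose j) * num_flaw j (j + k) (j + k) 0 * num_parking (N - j))"
    by (rule num_flaw_convolution)
  \<comment> \<open>Part (1) is used backwards for j cars on j + k spaces; its requirement j < j + k
    is where k \<ge> 1 enters.\<close>
  also have "\<dots> = (\<Sum>j\<le>N. (N choose j) *
      num_flaw_first 1 (Suc j) (j + k) (j + k) 0 * num_parking (N - j))"
    using \<open>1 \<le> k\<close> by (intro sum.cong refl) (simp add: num_flaw_first_1[unfolded One_nat_def])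
  also have "\<dots> = (\<Sum>i = 1..n. ((n - 1) choose (i - 1)) *
      num_flaw_first 1 i (i + k - 1) (i + k - 1) 0 * num_parking (n - i))"
    by (rule sum.reindex_bij_witness[of _ "\<lambda>i. i - 1" Suc]) (auto simp: n)
  finally show "num_flaw_first 1 n (n + k) (n + k) 0 =
      (\<Sum>i = 1..n. ((n - 1) choose (i - 1)) *
        num_flaw_first 1 i (i + k - 1) (i + k - 1) 0 * num_parking (n - i))" .
qed

end
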